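(* For any finite subsets $B_1\subset B_2\subset\mathcal{H}$, $$H_{B_2}\ge H_{B_1}.$$
   Context: $\mathcal{H}=\{(x_1,x_2)\in\mathbb{Z}^2: x_2\ge 0\}$; $L_n=\{(k,n):k\in\mathbb{Z}\}$ for integers $n\ge 0$. $(S_n)_{n\ge 0}$ is simple random walk on $\mathbb{Z}^2$, $P_z$ is its law when $S_0=z$, and for $A\subset\mathbb{Z}^2$, $\bar\tau_A=\min\{n\ge 0:S_n\in A\}$. For $B\subset\mathcal{H}$, $x\in B$ and an integer $N\geq 1$, $$H_{B,N}(x)=\sum_{z\in L_N\setminus B}P_z\big(S_{\bar\tau_{B\cup L_0}}=x\big),\qquad H_B(x)=\lim_{N\to\infty}H_{B,N}(x)$$ (the limit exists and is finite). For finite $B$, the (total) stationary harmonic measure of $B$ is $H_B=\sum_{x\in B}H_B(x)$. *)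

theory Defs
  imports "HOL-Probability.Probability" "HOL-Library.Product_Plus"
begin

type_synonym point = "int \<times> int"

definition half_plane :: "point set" where
  "half_plane = {z. 0 \<le> snd z}"

definition level :: "nat \<Rightarrow> point set" where
  "level n = {z. snd z = int n}"

definition step_pmf :: "point pmf" where
  "step_pmf = pmf_of_set {(1, 0), (- 1, 0), (0, 1), (0, - 1)}"

definition steps :: "point stream measure" where
  "steps = stream_space (measure_pmf step_pmf)"

text \<open>The path \<open>walk z \<omega>\<close>, for \<open>\<omega>\<close> distributed according to \<^term>\<open>steps\<close> (independent uniform
  steps), is simple random walk started at \<open>z\<close>; so \<open>P\<^sub>z(S \<in> E)\<close> is the \<^term>\<open>steps\<close>-measure of
  the set of all \<open>\<omega>\<close> with \<open>walk z \<omega> \<in> E\<close>.\<close>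

definition walk :: "point \<Rightarrow> point stream \<Rightarrow> nat \<Rightarrow> point" where
  "walk z \<omega> n = z + (\<Sum>i<n. \<omega> !! i)"

text \<open>The hitting time counts time \<open>0\<close>, and is \<open>\<infinity>\<close> for a path that never visits \<open>A\<close>.\<close>

definition hitting_time :: "point set \<Rightarrow> (nat \<Rightarrow> point) \<Rightarrow> enat" where
  "hitting_time A s = (INF n\<in>{n. s n \<in> A}. enat n)"

definition hit_prob :: "point \<Rightarrow> point set \<Rightarrow> point \<Rightarrow> ennreal" where
  "hit_prob z A x = emeasure steps
     {\<omega> \<in> space steps. \<exists>n. hitting_time A (walk z \<omega>) = enat n \<and> walk z \<omega> n = x}"

text \<open>Harmonic measures take values in \<^typ>\<open>ennreal\<close>, so that the infinite sum over a level needs no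
  summability convention.\<close>

definition harm_level :: "point set \<Rightarrow> nat \<Rightarrow> point \<Rightarrow> ennreal" where
  "harm_level B N x = (\<Sum>\<^sub>\<infinity>z\<in>level N - B. hit_prob z (B \<union> level 0) x)"

definition harm :: "point set \<Rightarrow> point \<Rightarrow> ennreal" where
  "harm B x = lim (\<lambda>N. harm_level B N x)"

definition total_harm :: "point set \<Rightarrow> ennreal" where
  "total_harm B = (\<Sum>x\<in>B. harm B x)"

end

theory Submission
  imports Defs
begin

text \<open>Put \<open>A\<^sub>i = B\<^sub>i \<union> L\<^sub>0\<close>. A path that first hits \<open>A\<^sub>1\<close> in a point of \<open>B\<^sub>1\<close> first hits \<open>A\<^sub>2\<close> in a
  point of \<open>B\<^sub>2\<close>: otherwise it would already have entered \<open>L\<^sub>0 - B\<^sub>2 \<subseteq> A\<^sub>1\<close>. So the inequality holds at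
  every level above both sets, and it remains to see that the level sums converge. Above \<open>B\<close>, the
  hitting probability is discrete harmonic in the starting point, and summing the mean value property
  over a level shows that the level sums form a harmonic sequence in one variable. Such a sequence is
  eventually monotone, hence convergent in \<^typ>\<open>ennreal\<close>.\<close>

section \<open>First hits along a path\<close>

definition hits_at :: "point set \<Rightarrow> point set \<Rightarrow> (nat \<Rightarrow> point) \<Rightarrow> bool" where
  "hits_at A X s \<longleftrightarrow> (\<exists>n. s n \<in> A \<inter> X \<and> (\<forall>m<n. s m \<notin> A))"

lemma hitting_time_eq_enat_iff:
  "hitting_time A s = enat n \<longleftrightarrow> s n \<in> A \<and> (\<forall>m<n. s m \<notin> A)"
proof (cases "\<exists>m. s m \<in> A")
  case True
  define l where "l = (LEAST m. s m \<in> A)"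
  have l: "s l \<in> A" "\<And>m. s m \<in> A \<Longrightarrow> l \<le> m"
    unfolding l_def using True by (auto intro: LeastI Least_le)
  have "hitting_time A s = enat l"
    unfolding hitting_time_def by (rule antisym) (auto intro!: INF_lower2 INF_greatest l)
  moreover have "l = n \<longleftrightarrow> s n \<in> A \<and> (\<forall>m<n. s m \<notin> A)"
    using l by (metis le_antisym not_le)
  ultimately show ?thesis by simp
next
  case False
  then show ?thesis
    by (auto simp: hitting_time_def top_enat_def)
qed

lemma hits_at_mono:
  assumes "hits_at (B \<union> L) B s" "B \<subseteq> B'"
  shows "hits_at (B' \<union> L) B' s"
proof -
  obtain n where n: "s n \<in> B" "\<And>m. m < n \<Longrightarrow> s m \<notin> B \<union> L"
    using assms(1) by (auto simp: hits_at_def)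
  define l where "l = (LEAST m. s m \<in> B' \<union> L)"
  have nA: "s n \<in> B' \<union> L" using n assms(2) by auto
  have l: "s l \<in> B' \<union> L" "\<forall>m<l. s m \<notin> B' \<union> L" "l \<le> n"
    unfolding l_def
    by (rule LeastI[of "\<lambda>m. s m \<in> B' \<union> L", OF nA], blast dest: not_less_Least,
        rule Least_le[of "\<lambda>m. s m \<in> B' \<union> L", OF nA])
  have "s l \<in> B'"
  proof (cases "l = n")
    case True
    with n(1) assms(2) show ?thesis by blast
  next
    \<comment> \<open>Here \<open>l < n\<close>, so the path has not met \<open>L\<close> at time
      \<open>l\<close> and the visit must be to \<open>B'\<close>.\<close>
    case False
    with l(1,3) n(2)[of l] show ?thesis by simp
  qed
  with l(2) show ?thesis by (auto simp: hits_at_def)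
qed

section \<open>The random walk and its hitting probabilities\<close>

lemma walk_0 [simp]: "walk z \<omega> 0 = z"
  by (simp add: walk_def)

lemma walk_SCons_Suc [simp]: "walk z (t ## \<omega>) (Suc n) = walk (z + t) \<omega> n"
  by (simp only: walk_def sum.lessThan_Suc_shift) (simp add: add.assoc)

lemma hits_at_walk_SCons:
  assumes "z \<notin> A"
  shows "hits_at A X (walk z (t ## \<omega>)) \<longleftrightarrow> hits_at A X (walk (z + t) \<omega>)"
proof -
  have "(\<exists>n. P n) \<longleftrightarrow> P 0 \<or> (\<exists>n. P (Suc n))" for P :: "nat \<Rightarrow> bool"
    by (metis not0_implies_Suc)
  from this[of "\<lambda>n. walk z (t ## \<omega>) n \<in> A \<inter> X \<and> (\<forall>m<n. walk z (t ## \<omega>) m \<notin> A)"]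
  show ?thesis
    unfolding hits_at_def by (simp add: assms All_less_Suc2)
qed

lemma measurable_walk [measurable]:
  "(\<lambda>\<omega>. walk z \<omega> n) \<in> steps \<rightarrow>\<^sub>M count_space UNIV"
proof (induction n)
  case 0
  then show ?case by simp
next
  case (Suc n)
  note [measurable] = Suc.IH
  have "(\<lambda>\<omega>. \<omega> !! n) \<in> steps \<rightarrow>\<^sub>M measure_pmf step_pmf"
    unfolding steps_def by measurable
  then have [measurable]: "(\<lambda>\<omega>. \<omega> !! n) \<in> steps \<rightarrow>\<^sub>M count_space UNIV"
    by simp
  \<comment> \<open>Since \<open>point\<close> is countable, it suffices to check measurability with
    the current position frozen at each \<open>w\<close>.\<close>
  have "(\<lambda>\<omega>. (\<lambda>w. w + \<omega> !! n) (walk z \<omega> n)) \<in> steps \<rightarrow>\<^sub>M count_space UNIV"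
    by (rule measurable_compose_countable) measurable
  then show ?case
    by (simp add: walk_def add.assoc)
qed

lemma sets_hits_at [measurable]:
  "{\<omega> \<in> space steps. hits_at A X (walk z \<omega>)} \<in> sets steps"
  unfolding hits_at_def by measurable

text \<open>With a set as target, the total over \<open>B\<close> becomes the probability of one
  event, so that totals for different sets compare by inclusion of events.\<close>

definition hit_prob_in :: "point \<Rightarrow> point set \<Rightarrow> point set \<Rightarrow> ennreal" where
  "hit_prob_in z A X = emeasure steps {\<omega> \<in> space steps. hits_at A X (walk z \<omega>)}"

lemma hit_prob_eq_hit_prob_in: "hit_prob z A x = hit_prob_in z A {x}"
  unfolding hit_prob_def hit_prob_in_def hits_at_def hitting_time_eq_enat_iff
  by (rule arg_cong[where f = "emeasure steps"]) auto

lemma sum_hit_prob: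
  assumes "finite X"
  shows "(\<Sum>x\<in>X. hit_prob z A x) = hit_prob_in z A X"
proof -
  let ?E = "\<lambda>x. {\<omega> \<in> space steps. hits_at A {x} (walk z \<omega>)}"
  have "x = y" if "hits_at A {x} s" "hits_at A {y} s" for x y s
    using that unfolding hits_at_def by (metis IntE linorder_neqE_nat singletonD)
  then have "disjoint_family_on ?E X"
    unfolding disjoint_family_on_def by blast
  then have "(\<Sum>x\<in>X. hit_prob z A x) = emeasure steps (\<Union>x\<in>X. ?E x)"
    unfolding hit_prob_eq_hit_prob_in hit_prob_in_def
    using assms by (intro sum_emeasure) auto
  also have "(\<Union>x\<in>X. ?E x) = {\<omega> \<in> space steps. hits_at A X (walk z \<omega>)}"
    by (auto simp: hits_at_def)
  finally show ?thesis
    by (simp add: hit_prob_in_def)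
qed

text \<open>Conditioning on the first step: a start outside \<open>A\<close> hits nothing at time 0,
  so the rest of the path decides. The factor 4 avoids division in \<open>ennreal\<close>.\<close>

lemma hit_prob_in_mean_value:
  assumes "z \<notin> A"
  shows "4 * hit_prob_in z A X =
    hit_prob_in (z + (1, 0)) A X + hit_prob_in (z + (- 1, 0)) A X +
    hit_prob_in (z + (0, 1)) A X + hit_prob_in (z + (0, - 1)) A X"
proof -
  let ?S = "{(1, 0), (- 1, 0), (0, 1), (0, - 1)} :: point set"
  have space: "space steps = UNIV"
    by (simp add: steps_def space_stream_space)
  have "hit_prob_in z A X =
      (\<integral>\<^sup>+t. emeasure steps {\<omega> \<in> space steps. t ## \<omega> \<in> {\<omega> \<in> space steps. hits_at A X (walk z \<omega>)}}
        \<partial>measure_pmf step_pmf)"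
    unfolding hit_prob_in_def using sets_hits_at[of A X z]
    unfolding steps_def by (rule prob_space.emeasure_stream_space[OF measure_pmf.prob_space_axioms])
  also have "\<dots> = (\<integral>\<^sup>+t. hit_prob_in (z + t) A X \<partial>measure_pmf step_pmf)"
    by (simp add: hit_prob_in_def space hits_at_walk_SCons[OF assms])
  also have "\<dots> = (\<Sum>t\<in>?S. hit_prob_in (z + t) A X) / 4"
    unfolding step_pmf_def by (subst nn_integral_pmf_of_set) auto
  finally show ?thesis
    by (simp add: ennreal_times_divide mult_divide_eq_ennreal mult.commute[of 4] add.assoc
        del: distrib_right_numeral distrib_left_numeral)
qed

section \<open>Sums over levels\<close>

text \<open>The library fact \<open>summable_on_ennreal\<close> only covers functions coerced from \<^typ>\<open>enat\<close>.\<close>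

lemma ennreal_valued_summable_on [simp]: "(f :: 'a \<Rightarrow> ennreal) summable_on S"
  by (rule nonneg_summable_on_complete) simp

lemma infsum_level: "infsum f (level n) = (\<Sum>\<^sub>\<infinity>k. f (k, int n))"
proof -
  have "bij_betw (\<lambda>k. (k, int n)) UNIV (level n)"
    by (auto simp: bij_betw_def inj_on_def level_def image_def)
  then show ?thesis
    by (rule infsum_reindex_bij_betw[symmetric])
qed

lemma infsum_int_shift: "(\<Sum>\<^sub>\<infinity>k. f (k + c)) = (\<Sum>\<^sub>\<infinity>k. f k)" for c :: int
  by (rule infsum_reindex_bij_betw) (rule bij_betw_byWitness[where f' = "\<lambda>k. k - c"], auto)

text \<open>Horizontal neighbours return the same level sum, by translation invariance; vertical
  neighbours give the two adjacent levels.\<close>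

lemma harmonic_level_sums:
  fixes u :: "point \<Rightarrow> ennreal"
  assumes "\<And>z. z \<in> level (Suc n) \<Longrightarrow>
    4 * u z = u (z + (1, 0)) + u (z + (- 1, 0)) + u (z + (0, 1)) + u (z + (0, - 1))"
  shows "4 * infsum u (level (Suc n)) =
    2 * infsum u (level (Suc n)) + infsum u (level (Suc (Suc n))) + infsum u (level n)"
proof -
  let ?N = "int (Suc n)"
  have four: "4 * a = a + a + a + a" for a :: ennreal
    using distrib_right[of 2 2 a] by (simp add: mult_2 add.assoc)
  have "4 * infsum u (level (Suc n)) = (\<Sum>\<^sub>\<infinity>k. u (k, ?N) + u (k, ?N) + u (k, ?N) + u (k, ?N))"
    unfolding infsum_level by (simp only: infsum_add ennreal_valued_summable_on four)
  also have "\<dots> = (\<Sum>\<^sub>\<infinity>k. u (k + 1, ?N) + u (k + - 1, ?N) + u (k, int (Suc (Suc n))) + u (k, int n))"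
  proof (rule infsum_cong)
    fix k :: int
    show "u (k, ?N) + u (k, ?N) + u (k, ?N) + u (k, ?N) =
        u (k + 1, ?N) + u (k + - 1, ?N) + u (k, int (Suc (Suc n))) + u (k, int n)"
      using assms[of "(k, ?N)"] by (simp add: level_def four ac_simps)
  qed
  also have "\<dots> = infsum u (level (Suc n)) + infsum u (level (Suc n)) +
      infsum u (level (Suc (Suc n))) + infsum u (level n)"
    by (simp only: infsum_level infsum_add ennreal_valued_summable_on
        infsum_int_shift[where f = "\<lambda>k. u (k, ?N)"])
  finally show ?thesis
    by (simp add: mult_2)
qed

text \<open>The term \<open>2 * s (Suc n)\<close> is not cancelled in the hypothesis because it may be infinite.\<close>

lemma harmonic_sequence_convergent:
  fixes s :: "nat \<Rightarrow> ennreal"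
  assumes harmonic: "\<And>n. 4 * s (Suc n) = 2 * s (Suc n) + s (Suc (Suc n)) + s n"
  shows "convergent s"
proof (cases "\<exists>n. s n \<le> s (Suc n)")
  case True
  then obtain m where m: "s m \<le> s (Suc m)" by blast
  \<comment> \<open>For finite values the hypothesis says that consecutive differences agree, so one
    non-decreasing step forces all later ones.\<close>
  have step: "s (Suc (Suc n)) \<ge> s (Suc n)" if le: "s n \<le> s (Suc n)" for n
  proof (cases "s (Suc n) = \<infinity>")
    case True
    \<comment> \<open>One index further on, the infinite \<open>s (Suc n)\<close> is a summand on
      the right.\<close>
    with harmonic[of "Suc n"] have "4 * s (Suc (Suc n)) = \<infinity>" by simp
    then show ?thesis by (simp add: ennreal_mult_eq_top_iff)
  next
    case False
    then have "s n \<noteq> \<infinity>" using le by (auto simp: top_unique)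
    have "2 * s (Suc n) + 2 * s (Suc n) = 2 * s (Suc n) + (s (Suc (Suc n)) + s n)"
      using harmonic[of n] by (simp add: add.assoc flip: distrib_right)
    then have "s (Suc n) + s (Suc n) = s (Suc (Suc n)) + s n"
      using False by (simp add: ennreal_add_left_cancel ennreal_mult_eq_top_iff mult_2)
    also have "\<dots> \<le> s (Suc (Suc n)) + s (Suc n)"
      using le by (rule add_left_mono)
    finally show ?thesis
      using False by (simp add: ennreal_add_left_cancel_le add.commute)
  qed
  have "s (n + m) \<le> s (Suc (n + m))" for n
    by (induction n) (auto intro: m step)
  then have "incseq (\<lambda>n. s (n + m))"
    by (intro incseq_SucI) simp
  then have "convergent (\<lambda>n. s (n + m))"
    using LIMSEQ_SUP convergentI by blast
  then show ?thesis by (simp add: convergent_ignore_initial_segment)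
next
  case False
  then have "decseq s"
    by (intro decseq_SucI) (simp add: not_le less_imp_le)
  then show ?thesis
    using LIMSEQ_INF convergentI by blast
qed

section \<open>Convergence and comparison of the totals\<close>

lemma finite_obtain_height:
  fixes B :: "point set"
  assumes "finite B"
  obtains M where "\<And>n. M \<le> n \<Longrightarrow> level n \<inter> B = {}"
proof
  fix n
  \<comment> \<open>The inserted 0 keeps \<open>Max\<close> meaningful for empty
    \<open>B\<close>.\<close>
  assume n: "Suc (Max (insert 0 ((\<lambda>z. nat (snd z)) ` B))) \<le> n"
  have "nat (snd z) < n" if "z \<in> B" for z
  proof -
    have "nat (snd z) \<le> Max (insert 0 ((\<lambda>z. nat (snd z)) ` B))"
      using assms that by (intro Max_ge) auto
    with n show ?thesis by simp
  qed
  then show "level n \<inter> B = {}"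
    by (fastforce simp: level_def)
qed

text \<open>Gives the \<open>lim\<close> in \<open>harm\<close> its meaning: from some height on,
  the level sums form a harmonic sequence.\<close>

lemma harm_level_tendsto_harm:
  assumes "finite B"
  shows "(\<lambda>N. harm_level B N x) \<longlonglongrightarrow> harm B x"
proof -
  obtain M where M: "\<And>n. M \<le> n \<Longrightarrow> level n \<inter> B = {}"
    using finite_obtain_height[OF assms] by blast
  let ?u = "\<lambda>z. hit_prob_in z (B \<union> level 0) {x}"
  have eq: "harm_level B n x = infsum ?u (level n)" if "M \<le> n" for n
    unfolding harm_level_def hit_prob_eq_hit_prob_in using M[OF that]
    by (intro infsum_cong_neutral) auto
  \<comment> \<open>After the shift by \<open>M\<close>, the centre level \<open>Suc (n + M)\<close>
    avoids both \<open>B\<close> and level 0, even for \<open>M = 0\<close>.\<close>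
  have "convergent (\<lambda>n. infsum ?u (level (n + M)))"
  proof (rule harmonic_sequence_convergent)
    fix n
    have "z \<notin> B \<union> level 0" if "z \<in> level (Suc (n + M))" for z
      using that M[of "Suc (n + M)"] by (auto simp: level_def)
    then show "4 * infsum ?u (level (Suc n + M)) =
        2 * infsum ?u (level (Suc n + M)) + infsum ?u (level (Suc (Suc n) + M)) +
        infsum ?u (level (n + M))"
      using harmonic_level_sums[of "n + M" ?u] hit_prob_in_mean_value by simp
  qed
  then have "convergent (\<lambda>n. harm_level B (n + M) x)"
    by (simp add: eq)
  then have "convergent (\<lambda>n. harm_level B n x)"
    by (rule convergent_ignore_initial_segment[THEN iffD1])
  then show ?thesis
    unfolding harm_def by (simp add: convergent_LIMSEQ_iff)
qed

lemma sum_harm_level: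
  assumes "finite B" "level N \<inter> B = {}"
  shows "(\<Sum>x\<in>B. harm_level B N x) = (\<Sum>\<^sub>\<infinity>z\<in>level N. hit_prob_in z (B \<union> level 0) B)"
proof -
  have "level N - B = level N" using assms(2) by blast
  moreover have "(\<Sum>x\<in>X. infsum (f x) S) = (\<Sum>\<^sub>\<infinity>z\<in>S. \<Sum>x\<in>X. f x z)"
    if "finite X" for X :: "point set" and S :: "point set" and f :: "point \<Rightarrow> point \<Rightarrow> ennreal"
    using that by (induction X) (simp_all add: infsum_add)
  ultimately show ?thesis
    using assms(1) by (simp add: harm_level_def sum_hit_prob)
qed

theorem proposition2:
  fixes B1 B2 :: "(int \<times> int) set"
  assumes "finite B1" and "finite B2"
    and "B1 \<subseteq> B2" and "B2 \<subseteq> half_plane"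
  shows "total_harm B2 \<ge> total_harm B1"
proof -
  obtain M where M: "\<And>n. M \<le> n \<Longrightarrow> level n \<inter> B2 = {}"
    using finite_obtain_height[OF assms(2)] by blast
  have lim: "(\<lambda>N. \<Sum>x\<in>B. harm_level B N x) \<longlonglongrightarrow> total_harm B" if "finite B" for B
    unfolding total_harm_def by (intro tendsto_sum harm_level_tendsto_harm that)
  \<comment> \<open>From height \<open>M\<close> on, both totals sum over the same starting points,
    all of \<open>level N\<close>, so the comparison can be made for each start.\<close>
  have "(\<Sum>x\<in>B1. harm_level B1 N x) \<le> (\<Sum>x\<in>B2. harm_level B2 N x)" if "M \<le> N" for N
  proof -
    have "level N \<inter> B1 = {}" "level N \<inter> B2 = {}"
      using M[OF that] assms(3) by auto
    moreover have "hit_prob_in z (B1 \<union> level 0) B1 \<le> hit_prob_in z (B2 \<union> level 0) B2" for z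
      unfolding hit_prob_in_def using assms(3) hits_at_mono
      by (intro emeasure_mono sets_hits_at) auto
    ultimately show ?thesis
      using assms(1,2) by (simp add: sum_harm_level infsum_mono)
  qed
  then show ?thesis
    by (intro LIMSEQ_le[OF lim lim] assms(1,2)) blast
qed

end
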